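(* As formal power series in $q$ (equivalently, for $|q|<1$), \[ \sum_{m,n\geq 0} \frac{(-1)^n q^{\frac{3n(3n+1)}{2} + m^2+ 3mn +m +3n+1}}{(q;q)_m(q^3;q^3)_n} = \frac{1}{(q;q^3)_\infty}-\frac{1}{(q^2;q^3)_\infty}. \]
   Context: $(A;q)_n=\prod_{j=0}^{n-1}(1-Aq^j)$, $(A;q)_\infty=\prod_{j\ge0}(1-Aq^j)$. *)

theory Defs
  imports "HOL-Analysis.Analysis" "HOL-Computational_Algebra.Formal_Power_Series"
begin

text \<open>
  Both notions are polymorphic so that they can be used for complex numbers and for formal
  power series alike. On the latter, limits refer to the library's metric on \<^typ>\<open>'a fps\<close>,
  i.e. the usual \<open>q\<close>-adic topology: convergence means that every coefficient is eventually constant.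
\<close>

definition qpoch :: "'a::comm_ring_1 \<Rightarrow> 'a \<Rightarrow> nat \<Rightarrow> 'a" where
  "qpoch A q n = (\<Prod>j<n. 1 - A * q ^ j)"

definition qpoch_inf :: "'a::{comm_ring_1, t2_space} \<Rightarrow> 'a \<Rightarrow> 'a" where
  "qpoch_inf A q = prodinf (\<lambda>j. 1 - A * q ^ j)"

end

theory Submission
  imports Defs
begin

text \<open>
  Put \<open>f\<^sub>k = \<Sum>\<^sub>m\<^sub>,\<^sub>n (-1)\<^sup>n q\<^bsup>3n(3n+1)/2 + m\<^sup>2 + 3mn + k(m+3n)\<^esup> / ((q;q)\<^sub>m (q\<^sup>3;q\<^sup>3)\<^sub>n)\<close>, so that the
  double series of the theorem is \<open>q f\<^sub>1\<close>. The sequence \<open>f\<close> tends to 1 and satisfies a three-term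
  recurrence. Two explicit finite sums of \<open>q\<close>-binomial coefficients (the convergents of Ramanujan's
  continued fraction for \<open>(q\<^sup>2;q\<^sup>3)\<^sub>\<infinity>/(q;q\<^sup>3)\<^sub>\<infinity>\<close>) satisfy the adjoint recurrence, so their Casoratians
  with \<open>f\<close> are constant. The initial values of these constants are \<open>f\<^sub>0\<close> and \<open>f\<^sub>0 - q f\<^sub>1\<close>, and by
  Cauchy's identity \<open>\<Sum>\<^sub>i p\<^bsup>i(i-1)\<^esup> z\<^sup>i / ((p;p)\<^sub>i (z;p)\<^sub>i) = 1/(z;p)\<^sub>\<infinity>\<close> with \<open>p = q\<^sup>3\<close> the limits are
  \<open>1/(q;q\<^sup>3)\<^sub>\<infinity>\<close> and \<open>1/(q\<^sup>2;q\<^sup>3)\<^sub>\<infinity>\<close>. Everything works in a complete metric ring with submultiplicative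
  distance to 0, which covers the complex numbers and formal power series at once.
\<close>

section \<open>Complete rings with a submultiplicative distance to zero\<close>

text \<open>No norm induces the \<open>q\<close>-adic metric: scaling a power series by a nonzero
  complex number leaves its distance to 0 unchanged. The estimates below rest on translation
  invariance and a submultiplicative distance to 0 alone.\<close>

class metric_comm_ring = comm_ring_1 + complete_space +
  assumes dist_add_cancel: "dist (x + z) (y + z) = dist x y"
    and dist_mult_le: "dist (x * y) 0 \<le> dist x 0 * dist y 0"
    and dist_one_zero: "dist 1 0 = 1"

definition nm :: "'a::metric_comm_ring \<Rightarrow> real" where
  "nm x = dist x 0"

lemma dist_eq_nm: "dist x y = nm (x - y)"
  using dist_add_cancel[of "x - y" y 0] by (simp add: nm_def)

lemma nm_ge_0 [simp]: "0 \<le> nm x"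
  by (simp add: nm_def)

lemma nm_0 [simp]: "nm 0 = 0"
  by (simp add: nm_def)

lemma nm_1 [simp]: "nm 1 = 1"
  by (simp add: nm_def dist_one_zero)

lemma nm_minus [simp]: "nm (- x) = nm x"
  by (metis dist_commute dist_eq_nm diff_0 nm_def)

lemma nm_triangle: "nm (x + y) \<le> nm x + nm y"
  using dist_triangle[of "x + y" 0 y] dist_add_cancel[of x y 0] by (simp add: nm_def)

lemma nm_triangle_diff: "nm (x - y) \<le> nm x + nm y"
  using nm_triangle[of x "- y"] by simp

lemma nm_mult: "nm (x * y) \<le> nm x * nm y"
  by (simp add: nm_def dist_mult_le)

lemma nm_power: "nm (x ^ n) \<le> nm x ^ n"
proof (induction n)
  case (Suc n)
  then show ?case
    using nm_mult[of x "x ^ n"] mult_left_mono[OF Suc nm_ge_0[of x]] by simp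
qed simp

lemma nm_sum: "nm (sum f A) \<le> (\<Sum>x\<in>A. nm (f x))"
  by (induction A rule: infinite_finite_induct) (auto intro: order_trans[OF nm_triangle])

lemma nm_minus_one_power [simp]: "nm ((- 1) ^ n) = 1"
  by (cases "even n") auto

lemma tendsto_nm_iff: "(f \<longlongrightarrow> l) F \<longleftrightarrow> ((\<lambda>x. nm (f x - l)) \<longlongrightarrow> 0) F"
  using tendsto_dist_iff[of f l F] by (simp add: dist_eq_nm)

lemma tendsto_nmI:
  assumes "\<And>x. nm (f x - l) \<le> g x" and "(g \<longlongrightarrow> 0) F"
  shows "(f \<longlongrightarrow> l) F"
  unfolding tendsto_nm_iff
  by (rule tendsto_sandwich[OF _ _ tendsto_const assms(2)]) (auto simp: assms(1))

instance metric_comm_ring \<subseteq> topological_ab_group_add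
proof
  fix a b :: 'a
  show "LIM x (nhds a \<times>\<^sub>F nhds b). fst x + snd x :> nhds (a + b)"
  proof (rule tendsto_nmI)
    show "nm (fst x + snd x - (a + b)) \<le> nm (fst x - a) + nm (snd x - b)" for x
      using nm_triangle[of "fst x - a" "snd x - b"] by (simp add: algebra_simps)
    have "((\<lambda>x. nm (fst x - a)) \<longlongrightarrow> 0) (nhds a \<times>\<^sub>F nhds b)"
         "((\<lambda>x. nm (snd x - b)) \<longlongrightarrow> 0) (nhds a \<times>\<^sub>F nhds b)"
      unfolding tendsto_nm_iff[symmetric] by (rule filterlim_fst filterlim_snd)+
    then show "((\<lambda>x. nm (fst x - a) + nm (snd x - b)) \<longlongrightarrow> 0) (nhds a \<times>\<^sub>F nhds b)"
      by (rule tendsto_add_zero)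
  qed
  show "(uminus \<longlongrightarrow> - a) (nhds a)"
  proof (rule tendsto_nmI)
    show "nm (- x - - a) \<le> nm (x - a)" for x
      using nm_minus[of "x - a"] by simp
    show "((\<lambda>x. nm (x - a)) \<longlongrightarrow> 0) (nhds a)"
      using tendsto_nm_iff[of "\<lambda>x. x" a "nhds a"] by (simp add: filterlim_ident)
  qed
qed

instance metric_comm_ring \<subseteq> topological_comm_monoid_mult
proof
  fix a b :: 'a
  let ?F = "nhds a \<times>\<^sub>F nhds b"
  show "LIM x ?F. fst x * snd x :> nhds (a * b)"
  proof (rule tendsto_nmI)
    show "nm (fst x * snd x - a * b) \<le> nm (fst x - a) * dist (snd x) 0 + nm a * nm (snd x - b)" for x
    proof -
      have "fst x * snd x - a * b = (fst x - a) * snd x + a * (snd x - b)"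
        by (simp add: algebra_simps)
      also have "nm \<dots> \<le> nm (fst x - a) * nm (snd x) + nm a * nm (snd x - b)"
        by (intro order_trans[OF nm_triangle] add_mono nm_mult)
      finally show ?thesis by (simp add: nm_def)
    qed
    have fs: "((\<lambda>x. fst x) \<longlongrightarrow> a) ?F" "((\<lambda>x. snd x) \<longlongrightarrow> b) ?F"
      by (rule filterlim_fst filterlim_snd)+
    then have "((\<lambda>x. nm (fst x - a)) \<longlongrightarrow> 0) ?F" "((\<lambda>x. nm (snd x - b)) \<longlongrightarrow> 0) ?F"
      unfolding tendsto_nm_iff[symmetric] by auto
    then have "((\<lambda>x. nm (fst x - a) * dist (snd x) 0 + nm a * nm (snd x - b))
                \<longlongrightarrow> 0 * dist b 0 + nm a * 0) ?F"
      by (intro tendsto_intros fs)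
    then show "((\<lambda>x. nm (fst x - a) * dist (snd x) 0 + nm a * nm (snd x - b)) \<longlongrightarrow> 0) ?F"
      by simp
  qed
qed

instance complex :: metric_comm_ring
  by standard (auto simp: dist_norm norm_mult)

instance fps :: (comm_ring_1) metric_comm_ring
proof
  fix f g h :: "'a fps"
  show "dist (f + h) (g + h) = dist f g"
    by (simp add: dist_fps_def)
  show "dist (f * g) 0 \<le> dist f 0 * dist g 0"
  proof (cases "f * g = 0")
    case False
    then have "f \<noteq> 0" "g \<noteq> 0" by auto
    \<comment> \<open>In each product contributing to a coefficient below this sum, one factor lies
      below its own subdegree. Zero divisors can raise the subdegree of \<open>f * g\<close>, hence
      only an inequality.\<close>
    have "subdegree f + subdegree g \<le> subdegree (f * g)"
    proof (rule subdegree_geI[OF False])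
      fix i assume i: "i < subdegree f + subdegree g"
      have "fps_nth f j * fps_nth g (i - j) = 0" if "j \<le> i" for j
      proof (cases "j < subdegree f")
        case False
        then have "i - j < subdegree g" using i that by simp
        then show ?thesis by (simp add: nth_less_subdegree_zero)
      qed (simp add: nth_less_subdegree_zero)
      then show "fps_nth (f * g) i = 0"
        by (simp add: fps_mult_nth)
    qed
    then have "(2::real) ^ (subdegree f + subdegree g) \<le> 2 ^ subdegree (f * g)"
      by (rule power_increasing) simp
    then have "inverse ((2::real) ^ subdegree (f * g)) \<le> inverse (2 ^ (subdegree f + subdegree g))"
      by (rule le_imp_inverse_le) simp
    then show ?thesis
      using \<open>f \<noteq> 0\<close> \<open>g \<noteq> 0\<close> False by (simp add: dist_fps_def power_add)
  qed (simp add: dist_fps_def)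
  show "dist (1 :: 'a fps) 0 = 1"
    by (simp add: dist_fps_def)
qed

section \<open>Majorised sums and infinite products\<close>

lemma nm_summable_imp_summable_on:
  fixes f :: "'b \<Rightarrow> 'a::metric_comm_ring"
  assumes le: "\<And>x. x \<in> A \<Longrightarrow> nm (f x) \<le> g x" and g: "g summable_on A"
  shows "f summable_on A"
proof -
  let ?F = "finite_subsets_at_top A"
  obtain L where L: "(sum g \<longlongrightarrow> L) ?F"
    using g by (auto simp: summable_on_def has_sum_def)
  \<comment> \<open>Cauchy criterion: once \<open>sum g\<close> stays within \<open>e / 4\<close> of
    its limit on all finite sets containing \<open>Z\<close>, enlarging \<open>Z\<close> changes
    \<open>sum f\<close> by less than \<open>e / 2\<close>.\<close>
  have "\<exists>P. eventually P ?F \<and> (\<forall>X Y. P X \<and> P Y \<longrightarrow> dist (sum f X) (sum f Y) < e)" if "e > 0" for e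
  proof -
    have "eventually (\<lambda>X. dist (sum g X) L < e / 4) ?F"
      using tendstoD[OF L, of "e / 4"] that by simp
    then have "\<exists>Z. finite Z \<and> Z \<subseteq> A \<and>
        (\<forall>X. finite X \<and> Z \<subseteq> X \<and> X \<subseteq> A \<longrightarrow> dist (sum g X) L < e / 4)"
      by (simp only: eventually_finite_subsets_at_top)
    then obtain Z where Z: "finite Z" "Z \<subseteq> A"
      and ZL: "\<And>X. finite X \<Longrightarrow> Z \<subseteq> X \<Longrightarrow> X \<subseteq> A \<Longrightarrow> dist (sum g X) L < e / 4"
      by (elim exE conjE) simp
    let ?P = "\<lambda>X. finite X \<and> Z \<subseteq> X \<and> X \<subseteq> A"
    have near: "dist (sum f X) (sum f Z) < e / 2" if X: "?P X" for X
    proof -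
      have "dist (sum f X) (sum f Z) = nm (sum f (X - Z))"
        using X Z by (simp add: dist_eq_nm sum_diff)
      also have "\<dots> \<le> (\<Sum>x\<in>X - Z. nm (f x))"
        by (rule nm_sum)
      also have "\<dots> \<le> sum g (X - Z)"
        using X by (intro sum_mono le) auto
      also have "\<dots> = sum g X - sum g Z"
        using X Z by (simp add: sum_diff)
      also have "\<dots> < e / 2"
      proof -
        have "dist (sum g X) L < e / 4" "dist (sum g Z) L < e / 4"
          using ZL X Z by auto
        then show ?thesis unfolding dist_real_def by linarith
      qed
      finally show ?thesis .
    qed
    have "eventually ?P ?F"
      unfolding eventually_finite_subsets_at_top using Z by (intro exI[of _ Z]) simp
    moreover have "dist (sum f X) (sum f Y) < e" if "?P X" "?P Y" for X Y
      using near[OF that(1)] near[OF that(2)] dist_triangle2[of "sum f X" "sum f Y" "sum f Z"]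
      by linarith
    ultimately show ?thesis
      by (intro exI[of _ ?P]) simp
  qed
  then have "cauchy_filter (filtermap (sum f) ?F)"
    by (simp add: cauchy_filter_metric_filtermap)
  then obtain l where "(sum f \<longlongrightarrow> l) ?F"
    using cauchy_filter_convergent[of "filtermap (sum f) ?F"]
    by (auto simp: convergent_filter_iff filterlim_def)
  then show ?thesis
    by (auto simp: summable_on_def has_sum_def)
qed

lemma nm_has_sum_le:
  fixes f :: "'b \<Rightarrow> 'a::metric_comm_ring"
  assumes f: "(f has_sum s) A" and g: "(g has_sum G) A"
    and le: "\<And>x. x \<in> A \<Longrightarrow> nm (f x) \<le> g x"
  shows "nm s \<le> G"
proof (rule tendsto_le[of "finite_subsets_at_top A"])
  show "(sum g \<longlongrightarrow> G) (finite_subsets_at_top A)"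
    using g by (simp add: has_sum_def)
  show "((\<lambda>X. nm (sum f X)) \<longlongrightarrow> nm s) (finite_subsets_at_top A)"
    unfolding nm_def using f by (intro tendsto_intros) (simp add: has_sum_def)
  show "\<forall>\<^sub>F X in finite_subsets_at_top A. nm (sum f X) \<le> sum g X"
    by (rule eventually_finite_subsets_at_top_weakI)
      (rule order_trans[OF nm_sum], rule sum_mono, rule le, auto)
qed simp

lemma nm_prod_one_plus_le: "nm (\<Prod>i\<in>A. 1 + x i) \<le> exp (\<Sum>i\<in>A. nm (x i))"
proof (induction A rule: infinite_finite_induct)
  case (insert a A)
  have "nm (1 + x a) \<le> exp (nm (x a))"
    using nm_triangle[of 1 "x a"] exp_ge_add_one_self[of "nm (x a)"] unfolding nm_1 by linarith
  then have "nm ((1 + x a) * (\<Prod>i\<in>A. 1 + x i)) \<le> exp (nm (x a)) * exp (\<Sum>i\<in>A. nm (x i))"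
    using insert.IH by (intro order_trans[OF nm_mult] mult_mono) auto
  with insert.hyps show ?case by (simp add: exp_add)
qed auto

lemma geometric_sum_le:
  fixes c :: real
  assumes "0 \<le> c" "c < 1"
  shows "(\<Sum>i<n. c ^ i) \<le> 1 / (1 - c)"
  using assms by (simp add: sum_gp_strict divide_right_mono)

lemma nm_prod_one_plus_geometric:
  assumes "\<And>i. nm (x i) \<le> C * c ^ i" "0 \<le> c" "c < 1" "0 \<le> C"
  shows "nm (\<Prod>i<n. 1 + x i) \<le> exp (C / (1 - c))"
proof -
  have "(\<Sum>i<n. nm (x i)) \<le> (\<Sum>i<n. C * c ^ i)"
    by (intro sum_mono assms)
  also have "\<dots> \<le> C * (1 / (1 - c))"
    unfolding sum_distrib_left[symmetric] by (intro mult_left_mono geometric_sum_le assms)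
  finally show ?thesis
    by (intro order_trans[OF nm_prod_one_plus_le]) simp
qed

text \<open>Consecutive partial products differ by \<open>p i * x i\<close>. As the products are
  bounded, these differences have a geometric majorant, and the telescoping series
  converges.\<close>

lemma convergent_prod_one_plus_geometric:
  fixes x :: "nat \<Rightarrow> 'a::metric_comm_ring"
  assumes x: "\<And>i. nm (x i) \<le> C * c ^ i" "0 \<le> c" "c < 1" "0 \<le> C"
  shows "convergent (\<lambda>n. \<Prod>i<n. 1 + x i)"
proof -
  define p where "p n = (\<Prod>i<n. 1 + x i)" for n
  define M where "M = exp (C / (1 - c))"
  have M: "nm (p n) \<le> M" for n
    unfolding p_def M_def by (rule nm_prod_one_plus_geometric[OF x])
  have "(\<lambda>i. p i * x i) summable_on UNIV"
  proof (rule nm_summable_imp_summable_on)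
    show "nm (p i * x i) \<le> M * C * c ^ i" for i
      using mult_mono[OF M[of i] x(1)[of i]] nm_mult[of "p i" "x i"] by (simp add: M_def)
    have "summable (\<lambda>i. M * C * c ^ i)"
      using x by (intro summable_mult summable_geometric) simp
    then show "(\<lambda>i. M * C * c ^ i) summable_on UNIV"
      using x by (subst summable_on_UNIV_nonneg_real_iff) (auto simp: M_def)
  qed
  then obtain l where "((\<lambda>i. p i * x i) has_sum l) UNIV"
    by (auto simp: summable_on_def)
  then have "(\<lambda>n. 1 + (\<Sum>i<n. p i * x i)) \<longlonglongrightarrow> 1 + l"
    by (intro tendsto_intros) (use has_sum_imp_sums sums_def in blast)
  moreover have "1 + (\<Sum>i<n. p i * x i) = p n" for n
    by (induction n) (auto simp: p_def algebra_simps)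
  ultimately show ?thesis
    by (auto simp: convergent_def p_def)
qed

lemma summable_on_geometric_pairs:
  fixes c :: real
  assumes "0 \<le> c" "c < 1"
  shows "(\<lambda>(m, n). c ^ m * c ^ n) summable_on (UNIV :: (nat \<times> nat) set)"
proof -
  have geo: "((\<lambda>n. c ^ n) has_sum (1 / (1 - c))) (UNIV :: nat set)"
    using assms by (intro norm_summable_imp_has_sum geometric_sums) (auto intro: summable_geometric)
  have "(\<lambda>(m, n). c ^ m * c ^ n) summable_on Sigma UNIV (\<lambda>_. UNIV)"
  proof (rule summable_on_SigmaI)
    show "((\<lambda>n. case (m, n) of (m, n) \<Rightarrow> c ^ m * c ^ n) has_sum (c ^ m * (1 / (1 - c)))) UNIV" for m
      using has_sum_cmult_right[OF geo, of "c ^ m"] by simp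
    show "(\<lambda>m. c ^ m * (1 / (1 - c))) summable_on UNIV"
      using has_sum_cmult_left[OF geo, of "1 / (1 - c)"] by (auto simp: summable_on_def)
  qed (use assms in auto)
  then show ?thesis by simp
qed

section \<open>Finite identities\<close>

text \<open>Invertibility is expressed by divisibility because power series do not form a field;
  \<open>div\<close> is then an exact division and \<open>r n\<close> a genuine inverse.\<close>

locale q_base =
  fixes q :: "'a::{metric_comm_ring, idom_divide}"
  assumes nm_q: "nm q < 1"
    and unit: "n > 0 \<Longrightarrow> (1 - q ^ n) dvd 1"
begin

definition r :: "nat \<Rightarrow> 'a" where
  "r n = 1 div (1 - q ^ n)"

lemma mult_r: "n > 0 \<Longrightarrow> (1 - q ^ n) * r n = 1"
proof -
  assume "n > 0"
  then obtain k where k: "1 = (1 - q ^ n) * k"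
    using unit[of n] by (auto elim: dvdE)
  then have "1 - q ^ n \<noteq> 0" by auto
  then have "(1 - q ^ n) * k div (1 - q ^ n) = k"
    by (rule nonzero_mult_div_cancel_left)
  then show "(1 - q ^ n) * r n = 1"
    unfolding r_def using k by simp
qed

lemma r_eq: "n > 0 \<Longrightarrow> r n = 1 + q ^ n * r n"
  using mult_r[of n] by (simp add: algebra_simps)

text \<open>
  In the usual notation \<open>R m = 1/(q;q)\<^sub>m\<close>, \<open>E s i = 1/(q\<^sup>s;q\<^sup>3)\<^sub>i\<close>, and \<open>Z b K j\<close> below is the product of
  \<open>(q\<^sup>b;q\<^sup>b)\<^sub>j\<close> with the \<open>q\<^sup>b\<close>-binomial coefficient of \<open>K\<close> over \<open>j\<close>. For \<open>j > K\<close> the truncated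
  subtraction produces a zero factor.
\<close>

definition R :: "nat \<Rightarrow> 'a" where
  "R m = (\<Prod>j<m. r (j + 1))"

definition E :: "nat \<Rightarrow> nat \<Rightarrow> 'a" where
  "E s i = (\<Prod>j<i. r (s + 3 * j))"

lemma R_Suc: "(1 - q ^ Suc m) * R (Suc m) = R m"
proof -
  have "R (Suc m) = R m * r (Suc m)"
    by (simp add: R_def)
  then have "(1 - q ^ Suc m) * R (Suc m) = R m * ((1 - q ^ Suc m) * r (Suc m))"
    by (simp only: mult_ac)
  then show ?thesis by (simp only: mult_r[OF zero_less_Suc] mult_1_right)
qed

lemma E_Suc: "E s (Suc i) = E s i * r (s + 3 * i)"
  by (simp add: E_def)

lemma E_Suc_shift: "E s (Suc i) = r s * E (s + 3) i"
  unfolding E_def by (subst prod.lessThan_Suc_shift) (simp add: add_ac)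

lemma E_0 [simp]: "E s 0 = 1"
  by (simp add: E_def)

lemma E_three_Suc: "(1 - q ^ (3 * Suc i)) * E 3 (Suc i) = E 3 i"
proof -
  have "(1 - q ^ (3 * Suc i)) * r (3 * Suc i) = 1" by (rule mult_r) simp
  then have "(1 - q ^ (3 * Suc i)) * E 3 (Suc i) = E 3 i * 1"
    by (metis E_Suc mult.left_commute mult_Suc_right)
  then show ?thesis by simp
qed

definition Z :: "nat \<Rightarrow> nat \<Rightarrow> nat \<Rightarrow> 'a" where
  "Z b K j = (\<Prod>l<j. 1 - q ^ (b * (K - l)))"

lemma Z_0 [simp]: "Z b K 0 = 1"
  by (simp add: Z_def)

lemma Z_Suc: "Z b K (Suc j) = Z b K j * (1 - q ^ (b * (K - j)))"
  by (simp add: Z_def)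

lemma Z_Suc_Suc: "Z b (Suc K) (Suc j) = (1 - q ^ (b * Suc K)) * Z b K j"
  unfolding Z_def by (subst prod.lessThan_Suc_shift) simp

lemma Z_eq_0: "K < j \<Longrightarrow> Z b K j = 0"
  unfolding Z_def by (rule prod_zero) (auto intro!: bexI[of _ K])

text \<open>The summand of Cauchy's identity for \<open>p = q ^ 3\<close> and
  \<open>z = q ^ s\<close>. The truncated \<open>i - 1\<close> is harmless, as it is multiplied by
  \<open>i\<close>.\<close>

definition w :: "nat \<Rightarrow> nat \<Rightarrow> 'a" where
  "w s i = q ^ (s * i + 3 * (i * (i - 1))) * E 3 i * E s i"

lemma w_Suc: "w s (Suc i) = q ^ (s + 6 * i) * r (3 + 3 * i) * r (s + 3 * i) * w s i"
proof -
  have "s * Suc i + 3 * (Suc i * (Suc i - 1)) = (s + 6 * i) + (s * i + 3 * (i * (i - 1)))"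
    by (cases i) (simp_all add: algebra_simps)
  then show ?thesis
    by (simp only: w_def E_Suc power_add) (simp only: mult_ac)
qed

text \<open>A finite form of Cauchy's identity.\<close>

lemma E_expansion:
  assumes "s > 0"
  shows "E s N = (\<Sum>i\<le>N. Z 3 N i * w s i)"
  using assms
proof (induction N arbitrary: s)
  case 0
  then show ?case by (simp add: w_def)
next
  case (Suc N)
  \<comment> \<open>The splitting \<open>1 - q^(3(N+1)) = q^(3(i+1)) (1 - q^(3(N-i))) + (1 -
    q^(3(i+1)))\<close> breaks each term at level \<open>Suc N\<close> into \<open>f (Suc i)\<close>
    and \<open>g i\<close>; its last bracket cancels a factor of \<open>E 3 (Suc i)\<close>.\<close>
  define f where "f i = q ^ (3 * i) * Z 3 N i * w s i" for i
  define g where "g i = Z 3 N i * E 3 i * q ^ (s * Suc i + 3 * (Suc i * i)) * E s (Suc i)" for i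
  have split: "Z 3 (Suc N) (Suc i) * w s (Suc i) = f (Suc i) + g i" for i
  proof (cases "i \<le> N")
    case True
    let ?A = "q ^ (s * Suc i + 3 * (Suc i * i)) * E s (Suc i)"
    have w: "w s (Suc i) = ?A * E 3 (Suc i)" by (simp add: w_def algebra_simps)
    have "q ^ (3 * Suc N) = q ^ (3 * Suc i) * q ^ (3 * (N - i))"
    proof -
      have "3 * Suc N = 3 * Suc i + 3 * (N - i)" using True by simp
      then show ?thesis by (simp only: power_add)
    qed
    then have qN: "1 - q ^ (3 * Suc N) = q ^ (3 * Suc i) * (1 - q ^ (3 * (N - i))) + (1 - q ^ (3 * Suc i))"
      by (simp add: algebra_simps)
    have "Z 3 (Suc N) (Suc i) * w s (Suc i)
       = q ^ (3 * Suc i) * (Z 3 N i * (1 - q ^ (3 * (N - i)))) * w s (Suc i)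
         + Z 3 N i * ?A * ((1 - q ^ (3 * Suc i)) * E 3 (Suc i))"
      unfolding Z_Suc_Suc w qN by (simp only: distrib_right distrib_left mult_ac)
    then show ?thesis
      unfolding E_three_Suc f_def g_def Z_Suc by (simp only: mult_ac)
  next
    case False
    then show ?thesis by (simp add: f_def g_def Z_eq_0)
  qed
  \<comment> \<open>Regrouped by equal \<open>i\<close>, the pieces form a term at level
    \<open>N\<close> with \<open>s + 3\<close> in place of \<open>s\<close>; this is why the
    induction generalises over \<open>s\<close>.\<close>
  have fg: "f i + g i = r s * (Z 3 N i * w (s + 3) i)" for i
  proof -
    have e1: "3 * i + (s * i + 3 * (i * (i - 1))) = (s + 3) * i + 3 * (i * (i - 1))"
      by (simp add: distrib_right)
    have e2: "s * Suc i + 3 * (Suc i * i) = (s + 3 * i) + ((s + 3) * i + 3 * (i * (i - 1)))"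
      by (cases i) (simp_all add: algebra_simps)
    let ?B = "Z 3 N i * E 3 i * q ^ ((s + 3) * i + 3 * (i * (i - 1)))"
    have "f i = ?B * E s i"
      unfolding f_def w_def e1[symmetric] power_add by (simp only: mult_ac)
    moreover have "g i = ?B * (q ^ (s + 3 * i) * E s (Suc i))"
      unfolding g_def e2 power_add[of q "s + 3 * i"] by (simp only: mult_ac)
    moreover have "E s i + q ^ (s + 3 * i) * E s (Suc i) = E s (Suc i)"
    proof -
      have "r (s + 3 * i) = 1 + q ^ (s + 3 * i) * r (s + 3 * i)"
        using Suc.prems by (intro r_eq) simp
      then have "E s i * r (s + 3 * i) = E s i * (1 + q ^ (s + 3 * i) * r (s + 3 * i))"
        by (rule arg_cong)
      also have "\<dots> = E s i + q ^ (s + 3 * i) * (E s i * r (s + 3 * i))"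
        by (simp only: distrib_left mult_1_right mult.left_commute)
      finally show ?thesis
        unfolding E_Suc ..
    qed
    ultimately have "f i + g i = ?B * E s (Suc i)"
      by (simp flip: distrib_left)
    then show ?thesis
      by (simp only: E_Suc_shift w_def mult_ac)
  qed
  have "(\<Sum>i\<le>Suc N. Z 3 (Suc N) i * w s i) = w s 0 + (\<Sum>i\<le>N. f (Suc i) + g i)"
    by (subst sum.atMost_Suc_shift) (simp add: split)
  also have "\<dots> = (f 0 + (\<Sum>i\<le>N. f (Suc i))) + (\<Sum>i\<le>N. g i)"
    by (simp add: sum.distrib f_def add_ac)
  also have "f 0 + (\<Sum>i\<le>N. f (Suc i)) = (\<Sum>i\<le>Suc N. f i)"
    by (rule sum.atMost_Suc_shift[symmetric])
  also have "\<dots> = (\<Sum>i\<le>N. f i)"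
    by (simp add: f_def Z_eq_0)
  also have "(\<Sum>i\<le>N. f i) + (\<Sum>i\<le>N. g i) = r s * (\<Sum>i\<le>N. Z 3 N i * w (s + 3) i)"
    by (simp add: sum.distrib[symmetric] fg sum_distrib_left)
  also have "\<dots> = E s (Suc N)"
    using Suc.IH[of "s + 3"] Suc.prems by (simp add: E_Suc_shift)
  finally show ?case by simp
qed

section \<open>A recurrence for sums of q-binomial coefficients\<close>

lemma Z_step:
  "(1 - q ^ (j + 2)) * (1 - q ^ (j + 3)) * (q ^ (2 * n + 1) - q ^ (n + 1 + j)) * Z 1 n j
     = q ^ (2 * j + 2) * (- (q ^ (n + 4 + j)) * Z 1 n (j + 3) - Z 1 (n + 2) (j + 3)
         + (1 + q ^ (n + 1)) * Z 1 (n + 1) (j + 3))"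
proof -
  have s: "j + 3 = Suc (Suc (Suc j))" "n + 2 = Suc (Suc n)" "n + 1 = Suc n" by auto
  \<comment> \<open>For \<open>n < j\<close> every \<open>Z\<close> vanishes; for
    \<open>n = j\<close> the bracket on the left and all \<open>Z\<close> on the right do; for
    \<open>n = j + 1\<close> only \<open>Z 1 (n + 2) (j + 3)\<close> survives on the right. From
    \<open>n = j + 2\<close> on no subtraction is truncated, and both sides are
    \<open>Z 1 n j\<close> times polynomials in \<open>q\<close>, \<open>q ^ j\<close> and
    \<open>q ^ (n - j - 2)\<close>.\<close>
  have "n < j \<or> n = j \<or> n = j + 1 \<or> j + 2 \<le> n"
    by linarith
  then consider "n < j" | "n = j" | "n = j + 1" | "j + 2 \<le> n"
    by blast
  then show ?thesis
  proof cases
    case 1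
    then have "Z 1 n j = 0" "Z 1 n (j + 3) = 0" "Z 1 (n + 1) (j + 3) = 0" "Z 1 (n + 2) (j + 3) = 0"
      by (auto intro: Z_eq_0)
    then show ?thesis by (simp only: mult_zero_right diff_0_right add_0_right)
  next
    case 2
    then have "Z 1 n (j + 3) = 0" "Z 1 (n + 1) (j + 3) = 0" "Z 1 (n + 2) (j + 3) = 0"
      by (auto intro: Z_eq_0)
    moreover have "q ^ (2 * n + 1) = q ^ (n + 1 + j)"
      using 2 by (intro arg_cong[of _ _ "power q"]) simp
    ultimately show ?thesis
      by (simp only: mult_zero_right mult_zero_left diff_0_right add_0_right diff_self)
  next
    case 3
    have e: "2 * n + 1 = (2 * j + 2) + 1" "n + 1 + j = 2 * j + 2"
      using 3 by auto
    have e2: "Suc (Suc n) = j + 3" "Suc n = j + 2"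
      using 3 by auto
    have p: "q ^ Suc (Suc n) = q ^ (j + 3)" "q ^ Suc n = q ^ (j + 2)"
      by (rule arg_cong[OF e2(1)], rule arg_cong[OF e2(2)])
    have d: "n - j = 1" using 3 by simp
    have z: "Z 1 (n + 2) (j + 3) = (1 - q ^ (j + 3)) * ((1 - q ^ (j + 2)) * (Z 1 n j * (1 - q)))"
      unfolding p[symmetric] unfolding s Z_Suc_Suc unfolding Z_Suc mult_1 d power_one_right ..
    have z0: "Z 1 n (j + 3) = 0" "Z 1 (n + 1) (j + 3) = 0"
      using 3 by (auto intro: Z_eq_0)
    show ?thesis
      unfolding e power_add[of q "2 * j + 2" 1] power_one_right z z0 by algebra
  next
    case 4
    then obtain e where e: "n = j + 2 + e"
      using le_Suc_ex[of "j + 2" n] by auto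
    have d: "n - j = e + 2" "n - Suc j = e + 1" "n - Suc (Suc j) = e"
      using e by auto
    define Q U z where "Q = q ^ j" and "U = q ^ e" and "z = Z 1 n j"
    have n: "2 * n + 1 = j + j + e + e + 5" "n + 1 + j = j + j + e + 3" "2 * j + 2 = j + j + 2"
      "n + 4 + j = j + j + e + 6" "Suc (Suc n) = j + e + 4" "Suc n = j + e + 3"
      using e by auto
    have p: "q ^ (j + 2) = Q * q ^ 2" "q ^ (j + 3) = Q * q ^ 3"
      "q ^ (2 * n + 1) = Q * Q * U * U * q ^ 5" "q ^ (n + 1 + j) = Q * Q * U * q ^ 3"
      "q ^ (2 * j + 2) = Q * Q * q ^ 2" "q ^ (n + 4 + j) = Q * Q * U * q ^ 6"
      "q ^ (e + 2) = U * q ^ 2" "q ^ (e + 1) = U * q" "q ^ e = U"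
      unfolding n(1-4) Q_def U_def by (simp_all only: power_add power_one_right)
    have pS: "q ^ Suc n = Q * U * q ^ 3"
      unfolding n(6) Q_def U_def by (simp only: power_add)
    have pSS: "q ^ Suc (Suc n) = Q * U * q ^ 4"
      unfolding n(5) Q_def U_def by (simp only: power_add)
    have p': "q ^ (n + 1) = Q * U * q ^ 3"
      using pS by simp
    have Z: "Z 1 n (j + 3) = z * (1 - U * q ^ 2) * (1 - U * q) * (1 - U)"
      "Z 1 (n + 2) (j + 3) = (1 - Q * U * q ^ 4) * ((1 - Q * U * q ^ 3) * (z * (1 - U * q ^ 2)))"
      "Z 1 (n + 1) (j + 3) = (1 - Q * U * q ^ 3) * (z * (1 - U * q ^ 2) * (1 - U * q))"
      unfolding s Z_Suc_Suc by (simp_all only: Z_Suc mult_1 d p pS pSS z_def)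
    show ?thesis
      unfolding p p' Z z_def[symmetric] by algebra
  qed
qed

text \<open>Used with \<open>a = 0\<close>, \<open>d i = w 2 i\<close> and with
  \<open>a = 1\<close>, \<open>d i = r 1 * w 4 i\<close>. Up to powers of \<open>q\<close> the
  summands are then the \<open>q\<close>-binomial coefficients of \<open>K\<close> over
  \<open>3 * i + a\<close> times \<open>(q;q^3)_i\<close> and \<open>(q^2;q^3)_i\<close>
  respectively.\<close>

definition Y :: "nat \<Rightarrow> (nat \<Rightarrow> 'a) \<Rightarrow> nat \<Rightarrow> 'a" where
  "Y a d K = (\<Sum>i\<le>K. Z 1 K (3 * i + a) * d i)"

lemma Y_extend:
  assumes "K \<le> N"
  shows "Y a d K = (\<Sum>i\<le>N. Z 1 K (3 * i + a) * d i)"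
  unfolding Y_def using assms by (intro sum.mono_neutral_left) (auto simp: Z_eq_0)

text \<open>The assumed ratio of consecutive \<open>d\<close> restores the denominators cleared in
  \<open>Z_step\<close>, which makes the recurrence telescope in \<open>i\<close>.\<close>

lemma Y_rec:
  assumes d: "\<And>i. d (Suc i) = q ^ (2 * (3 * i + a) + 2) * r (3 * i + a + 2) * r (3 * i + a + 3) * d i"
    and a: "a = 0 \<or> a = 1"
  shows "Y a d (n + 2) = (1 + q ^ (n + 1)) * Y a d (n + 1) - q ^ (2 * n + 1) * Y a d n"
proof -
  define T where "T i = d i * (Z 1 (n + 2) (3 * i + a) - (1 + q ^ (n + 1)) * Z 1 (n + 1) (3 * i + a)
     + q ^ (2 * n + 1) * Z 1 n (3 * i + a))" for i
  \<comment> \<open>The summands \<open>T\<close> of the recurrence telescope, with \<open>H\<close> as antidifference.\<close>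
  define H where "H i = d i * (q ^ (2 * n + 1) - q ^ (n + 1 + (3 * i + a))) * Z 1 n (3 * i + a)" for i
  have step: "H i + T (Suc i) = H (Suc i)" for i
  proof -
    define j where "j = 3 * i + a"
    have J: "3 * Suc i + a = j + 3" by (simp add: j_def)
    define c where "c = r (j + 2) * r (j + 3) * d i"
    have dS: "d (Suc i) = q ^ (2 * j + 2) * c"
      unfolding d c_def j_def by (simp add: mult_ac)
    have "(1 - q ^ (j + 2)) * (1 - q ^ (j + 3)) * c
        = ((1 - q ^ (j + 2)) * r (j + 2)) * ((1 - q ^ (j + 3)) * r (j + 3)) * d i"
      by (simp add: c_def mult_ac)
    also have "\<dots> = d i"
      using mult_r[of "j + 2"] mult_r[of "j + 3"] by simp
    finally have di: "d i = (1 - q ^ (j + 2)) * (1 - q ^ (j + 3)) * c" ..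
    have "H i = c * ((1 - q ^ (j + 2)) * (1 - q ^ (j + 3)) * (q ^ (2 * n + 1) - q ^ (n + 1 + j)) * Z 1 n j)"
      unfolding H_def j_def[symmetric] di by (simp only: mult_ac)
    also have "\<dots> = d (Suc i) * (- (q ^ (n + 4 + j)) * Z 1 n (j + 3) - Z 1 (n + 2) (j + 3)
         + (1 + q ^ (n + 1)) * Z 1 (n + 1) (j + 3))"
      unfolding Z_step dS by (simp only: mult_ac)
    finally show ?thesis
      unfolding H_def[of "Suc i"] T_def J by (simp add: algebra_simps)
  qed
  \<comment> \<open>The telescoping can start here because the factor
    \<open>(1 - q^(j+2)) (1 - q^(j+3))\<close> of \<open>Z_step\<close> formally vanishes at
    \<open>j = a - 3\<close> for both offsets \<open>a\<close>.\<close>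
  have "T 0 = H 0"
    using a by (auto simp: T_def H_def Z_Suc algebra_simps power_add mult_2 power2_eq_square)
  then have sum: "(\<Sum>i\<le>N. T i) = H N" for N
    by (induction N) (simp_all add: step)
  have "(\<Sum>i\<le>n + 2. T i) = 0"
    unfolding sum by (simp add: H_def Z_eq_0)
  moreover have "(\<Sum>i\<le>n + 2. T i) = Y a d (n + 2) - (1 + q ^ (n + 1)) * Y a d (n + 1)
      + q ^ (2 * n + 1) * Y a d n"
    unfolding Y_extend[of n "n + 2", OF le_add1] Y_extend[of "n + 1" "n + 2", OF add_left_mono[OF one_le_numeral]]
      Y_extend[of "n + 2" "n + 2", OF order_refl]
    by (simp add: T_def sum_distrib_left sum.distrib sum_subtractf algebra_simps del: sum.atMost_Suc)
  ultimately show ?thesis by (simp add: algebra_simps)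
qed


section \<open>Bounds and limits of the finite sums\<close>

abbreviation c :: real where
  "c \<equiv> nm q"

lemma nm_q_power: "j \<le> n \<Longrightarrow> nm (q ^ n) \<le> c ^ j"
  using nm_power[of q n] power_decreasing[of j n c] nm_q by simp

lemma q_power_tendsto: "(\<lambda>n. q ^ n) \<longlonglongrightarrow> 0"
proof (rule tendsto_nmI)
  show "nm (q ^ n - 0) \<le> c ^ n" for n
    using nm_power[of q n] by simp
  show "(\<lambda>n. c ^ n) \<longlonglongrightarrow> 0"
    using nm_q by (intro LIMSEQ_power_zero) simp
qed

text \<open>The identity \<open>r n = 1 + q ^ n * r n\<close> gives \<open>x \<le> 1 + c * x\<close>
  for \<open>x = nm (r n)\<close>.\<close>

lemma nm_r:
  assumes "n > 0"
  shows "nm (r n) \<le> 1 / (1 - c)"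
proof -
  have "nm (r n) \<le> 1 + nm (q ^ n * r n)"
    using nm_triangle[of 1 "q ^ n * r n"] r_eq[OF assms] by simp
  also have "nm (q ^ n * r n) \<le> c * nm (r n)"
    using nm_q_power[of 1 n] assms
    by (intro order_trans[OF nm_mult] mult_right_mono) auto
  finally have "nm (r n) * (1 - c) \<le> 1" by (simp add: algebra_simps)
  then show ?thesis using nm_q by (simp add: pos_le_divide_eq)
qed

lemma nm_r_minus_one:
  assumes "j < n"
  shows "nm (r n - 1) \<le> 1 / (1 - c) * c ^ j"
proof -
  have "r n - 1 = r n * q ^ n"
    using r_eq[of n] assms by (simp add: algebra_simps)
  also have "nm \<dots> \<le> nm (r n) * nm (q ^ n)"
    by (rule nm_mult)
  also have "\<dots> \<le> 1 / (1 - c) * c ^ j"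
    using nm_q assms by (intro mult_mono nm_r nm_q_power) auto
  finally show ?thesis .
qed

text \<open>A bound for products of factors \<open>r (g j)\<close> with \<open>j < g j\<close>,
  uniform in their number: the majorants \<open>1 / (1 - c) * c ^ j\<close> of the deviations from 1
  sum to the exponent.\<close>

definition M :: real where
  "M = exp (1 / (1 - c) / (1 - c))"

lemma M_pos: "0 \<le> M"
  by (simp add: M_def)

lemma nm_prod_r:
  assumes "\<And>j. j < g j"
  shows "nm (\<Prod>j<n. r (g j)) \<le> M"
  using nm_prod_one_plus_geometric[of "\<lambda>j. r (g j) - 1" "1 / (1 - c)" c n]
    nm_r_minus_one[OF assms] nm_q by (simp add: M_def)

lemma nm_R: "nm (R n) \<le> M"
  unfolding R_def by (rule nm_prod_r) simp

lemma nm_E: "s > 0 \<Longrightarrow> nm (E s n) \<le> M"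
  unfolding E_def by (rule nm_prod_r) simp

lemma convergent_E:
  assumes "s > 0"
  shows "convergent (E s)"
proof -
  have "nm (r (s + 3 * j) - 1) \<le> 1 / (1 - c) * c ^ j" for j
    using assms by (intro nm_r_minus_one) simp
  then have "convergent (\<lambda>n. \<Prod>j<n. 1 + (r (s + 3 * j) - 1))"
    using nm_q by (intro convergent_prod_one_plus_geometric[where C = "1 / (1 - c)"]) auto
  then show ?thesis by (simp add: E_def[abs_def])
qed

definition X :: "nat \<Rightarrow> nat \<Rightarrow> 'a" where
  "X s n = (\<Prod>j<n. 1 - q ^ (s + 3 * j))"

lemma convergent_X: "convergent (X s)"
proof -
  have "nm (- (q ^ (s + 3 * j))) \<le> 1 * c ^ j" for j
    using nm_q_power[of j "s + 3 * j"] by simp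
  then have "convergent (\<lambda>n. \<Prod>j<n. 1 + - (q ^ (s + 3 * j)))"
    using nm_q by (intro convergent_prod_one_plus_geometric[where C = 1]) auto
  then show ?thesis by (simp add: X_def[abs_def])
qed

lemma X_E: "s > 0 \<Longrightarrow> X s n * E s n = 1"
  unfolding X_def E_def by (subst prod.distrib[symmetric]) (simp add: mult_r)

lemma prod_R: "(\<Prod>j<n. 1 - q ^ Suc j) * R n = 1"
  unfolding R_def by (subst prod.distrib[symmetric]) (simp add: mult_r flip: Suc_eq_plus1 del: power_Suc)

lemma prodinf_mult_E_limit:
  assumes "s > 0" and E: "E s \<longlonglongrightarrow> e"
  shows "prodinf (\<lambda>j. 1 - q ^ (s + 3 * j)) * e = 1"
proof -
  obtain x where x: "X s \<longlonglongrightarrow> x"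
    using convergent_X by (auto simp: convergent_def)
  have "(\<lambda>n. X s n * E s n) \<longlonglongrightarrow> x * e"
    by (intro tendsto_mult x E)
  \<comment> \<open>This also shows that the limit \<open>x\<close> is nonzero, as
    \<open>has_prod\<close> demands here.\<close>
  then have xe: "x * e = 1"
    using X_E[OF assms(1)] by (simp add: LIMSEQ_const_iff)
  have "(\<lambda>n. X s (Suc n)) \<longlonglongrightarrow> x"
    using x by (rule LIMSEQ_Suc)
  then have "(\<lambda>j. 1 - q ^ (s + 3 * j)) has_prod x"
    using xe by (auto simp: has_prod_def raw_has_prod_def X_def lessThan_Suc_atMost)
  then have "x = prodinf (\<lambda>j. 1 - q ^ (s + 3 * j))"
    by (rule has_prod_unique)
  with xe show ?thesis by simp
qed

text \<open>For \<open>j \<le> K\<close> the exponents \<open>K - l\<close> are distinct, so the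
  full geometric series bounds the sum, uniformly in \<open>K\<close> and \<open>j\<close>.\<close>

lemma nm_Z:
  assumes "b > 0"
  shows "nm (Z b K j) \<le> exp (1 / (1 - c))"
proof (cases "j \<le> K")
  case True
  have "(\<Sum>l<j. nm (- (q ^ (b * (K - l))))) \<le> (\<Sum>l<j. c ^ (K - l))"
    using assms by (intro sum_mono) (auto intro: nm_q_power)
  also have "\<dots> \<le> (\<Sum>l<Suc K. c ^ (K - l))"
    using True by (intro sum_mono2) auto
  also have "\<dots> = (\<Sum>l<Suc K. c ^ l)"
    using sum.nat_diff_reindex[of "\<lambda>l. c ^ l" "Suc K"] by simp
  also have "\<dots> \<le> 1 / (1 - c)"
    using nm_q by (intro geometric_sum_le) auto
  finally have "exp (\<Sum>l<j. nm (- (q ^ (b * (K - l))))) \<le> exp (1 / (1 - c))" by simp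
  then have "nm (\<Prod>l<j. 1 + - (q ^ (b * (K - l)))) \<le> exp (1 / (1 - c))"
    by (rule order_trans[OF nm_prod_one_plus_le])
  then show ?thesis by (simp add: Z_def)
qed (simp add: Z_eq_0)

lemma Z_tendsto:
  assumes "b > 0"
  shows "(\<lambda>K. Z b K j) \<longlonglongrightarrow> 1"
proof (induction j)
  case (Suc j)
  have "(\<lambda>K. q ^ (b * (K - j))) \<longlonglongrightarrow> 0"
  proof (rule tendsto_nmI)
    show "nm (q ^ (b * (K - j)) - 0) \<le> c ^ (K - j)" for K
      using assms nm_q_power[of "K - j" "b * (K - j)"] by simp
    have "(\<lambda>n. c ^ n) \<longlonglongrightarrow> 0"
      using nm_q by (intro LIMSEQ_power_zero) simp
    then show "(\<lambda>K. c ^ (K - j)) \<longlonglongrightarrow> 0"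
      by (rule filterlim_compose) (rule filterlim_minus_const_nat_at_top)
  qed
  then have "(\<lambda>K. Z b K j * (1 - q ^ (b * (K - j)))) \<longlonglongrightarrow> 1 * (1 - 0)"
    by (intro tendsto_intros Suc)
  then show ?case by (simp add: Z_Suc)
qed simp

text \<open>Comparing the two sums avoids finding either limit. The differences of weights tend to 0
  termwise under a geometric majorant, so Tannery's theorem for reals applies to the norms, extended
  by 0 beyond \<open>K\<close>.\<close>

lemma tannery_diff:
  assumes lim: "\<And>i. (\<lambda>K. A K i) \<longlonglongrightarrow> 1" "\<And>i. (\<lambda>K. B K i) \<longlonglongrightarrow> 1"
    and bound: "\<And>K i. nm (A K i) \<le> N" "\<And>K i. nm (B K i) \<le> N"
    and v: "\<And>i. nm (v i) \<le> D * c ^ i"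
  shows "(\<lambda>K. (\<Sum>i\<le>K. A K i * v i) - (\<Sum>i\<le>K. B K i * v i)) \<longlonglongrightarrow> (0::'a)"
proof -
  have N: "0 \<le> N" using order_trans[OF nm_ge_0 bound(1)] .
  have D: "0 \<le> D" using order_trans[OF nm_ge_0 v[of 0]] by simp
  define a where "a i K = (if i \<le> K then nm ((A K i - B K i) * v i) else 0)" for i K
  have "a i \<longlonglongrightarrow> 0" for i
  proof -
    have "(\<lambda>K. (A K i - B K i) * v i) \<longlonglongrightarrow> (1 - 1) * v i"
      by (intro tendsto_intros lim)
    then have "(\<lambda>K. nm ((A K i - B K i) * v i)) \<longlonglongrightarrow> 0"
      by (subst (asm) tendsto_nm_iff) simp
    then show ?thesis
      by (rule Lim_transform_eventually)
        (auto simp: a_def intro!: eventually_mono[OF eventually_ge_at_top[of i]])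
  qed
  moreover have "norm (a i K) \<le> (N + N) * (D * c ^ i)" for i K
  proof -
    have "nm ((A K i - B K i) * v i) \<le> (N + N) * (D * c ^ i)"
      using N by (intro order_trans[OF nm_mult] mult_mono v order_trans[OF nm_triangle_diff] add_mono bound) auto
    moreover have "0 \<le> (N + N) * (D * c ^ i)"
      using N D by (intro mult_nonneg_nonneg) auto
    ultimately show ?thesis by (simp add: a_def)
  qed
  then have "\<forall>\<^sub>F (i, K) in sequentially \<times>\<^sub>F sequentially. norm (a i K) \<le> (N + N) * (D * c ^ i)"
    by (intro always_eventually) auto
  moreover have "summable (\<lambda>i. (N + N) * (D * c ^ i))"
    using nm_q by (intro summable_mult summable_geometric) simp
  ultimately have "(\<lambda>K. suminf (\<lambda>i. a i K)) \<longlonglongrightarrow> suminf (\<lambda>i. 0)"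
    by (intro tannerys_theorem[where M = "\<lambda>i. (N + N) * (D * c ^ i)", THEN conjunct2, THEN conjunct2]) auto
  moreover have "suminf (\<lambda>i. a i K) = (\<Sum>i\<le>K. a i K)" for K
    by (rule suminf_finite) (auto simp: a_def)
  ultimately have sum0: "(\<lambda>K. \<Sum>i\<le>K. a i K) \<longlonglongrightarrow> 0" by simp
  show ?thesis
  proof (rule tendsto_nmI[OF _ sum0])
    show "nm ((\<Sum>i\<le>K. A K i * v i) - (\<Sum>i\<le>K. B K i * v i) - 0) \<le> (\<Sum>i\<le>K. a i K)" for K
      using nm_sum[of "\<lambda>i. (A K i - B K i) * v i" "{..K}"]
      by (simp add: a_def left_diff_distrib sum_subtractf)
  qed
qed

lemma nm_w:
  assumes "s > 0"
  shows "nm (w s i) \<le> M * M * c ^ i"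
proof -
  have "nm (w s i) \<le> nm (q ^ (s * i + 3 * (i * (i - 1)))) * nm (E 3 i) * nm (E s i)"
    unfolding w_def by (intro order_trans[OF nm_mult] mult_right_mono nm_mult) auto
  also have "\<dots> \<le> c ^ i * M * M"
    using assms M_pos by (intro mult_mono nm_q_power nm_E) (auto simp: trans_le_add1)
  finally show ?thesis by (simp add: mult_ac)
qed

text \<open>The weights \<open>Z 1 K (3 * i + a)\<close> and \<open>Z 3 K i\<close> both tend to 1,
  and with the latter the sum is exactly \<open>u * E s K\<close> by the finite Cauchy
  identity.\<close>

lemma Y_tendsto:
  assumes s: "s > 0" and E: "E s \<longlonglongrightarrow> e"
  shows "Y a (\<lambda>i. u * w s i) \<longlonglongrightarrow> u * e"
proof -
  have v: "nm (u * w s i) \<le> nm u * (M * M) * c ^ i" for i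
    using nm_mult[of u "w s i"] mult_left_mono[OF nm_w[OF s, of i] nm_ge_0[of u]]
    by (simp add: mult_ac)
  have "(\<lambda>K. (\<Sum>i\<le>K. Z 1 K (3 * i + a) * (u * w s i)) - (\<Sum>i\<le>K. Z 3 K i * (u * w s i))) \<longlonglongrightarrow> 0"
    by (rule tannery_diff[OF _ _ _ _ v, where N = "exp (1 / (1 - c))"])
      (auto intro: Z_tendsto nm_Z)
  moreover have "(\<Sum>i\<le>K. Z 3 K i * (u * w s i)) = u * E s K" for K
    unfolding E_expansion[OF s] sum_distrib_left by (simp only: mult_ac)
  ultimately have "(\<lambda>K. Y a (\<lambda>i. u * w s i) K - u * E s K) \<longlonglongrightarrow> 0"
    by (simp add: Y_def)
  then have "(\<lambda>K. (Y a (\<lambda>i. u * w s i) K - u * E s K) + u * E s K) \<longlonglongrightarrow> 0 + u * e"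
    by (intro tendsto_intros E)
  then show ?thesis by simp
qed

section \<open>The double series\<close>

definition e :: "nat \<Rightarrow> nat \<Rightarrow> nat" where
  "e m n = 3 * n * (3 * n + 1) div 2 + m\<^sup>2 + 3 * m * n"

lemma triangular_Suc: "3 * Suc n * (3 * Suc n + 1) div 2 = 3 * n * (3 * n + 1) div 2 + (9 * n + 6)"
proof -
  have "3 * Suc n * (3 * Suc n + 1) = 3 * n * (3 * n + 1) + (9 * n + 6) * 2"
    by (simp add: algebra_simps)
  then show ?thesis
    by (simp only:) (subst div_mult_self1, simp_all only: add.commute)
qed

lemma e_Suc_left: "e (Suc m) n = e m n + (2 * m + 3 * n + 1)"
  by (simp add: e_def power2_eq_square algebra_simps)

lemma e_Suc_right: "e m (Suc n) = e m n + (9 * n + 6 + 3 * m)"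
  unfolding e_def triangular_Suc by (simp add: algebra_simps)

lemma e_ge: "m + n \<le> e m n"
proof -
  have "n \<le> 3 * n * (3 * n + 1) div 2"
  proof (induction n)
    case (Suc n)
    then show ?case unfolding triangular_Suc by linarith
  qed simp
  moreover have "m \<le> m\<^sup>2"
    by (simp add: power2_eq_square)
  ultimately show ?thesis
    unfolding e_def by linarith
qed

definition T :: "nat \<Rightarrow> nat \<times> nat \<Rightarrow> 'a" where
  "T k = (\<lambda>(m, n). (- 1) ^ n * q ^ (e m n + k * (m + 3 * n)) * R m * E 3 n)"

lemma nm_T_le: "nm (T k (m, n)) \<le> nm (q ^ (e m n + k * (m + 3 * n))) * (M * M)"
proof -
  let ?p = "q ^ (e m n + k * (m + 3 * n))"
  have "nm (T k (m, n)) \<le> nm ((- 1) ^ n :: 'a) * nm ?p * nm (R m) * nm (E 3 n)"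
    unfolding T_def prod.case by (intro order_trans[OF nm_mult] mult_right_mono nm_ge_0 order_refl)
  also have "\<dots> \<le> 1 * nm ?p * M * M"
    using M_pos by (intro mult_mono nm_R nm_E mult_nonneg_nonneg) auto
  finally show ?thesis by (simp add: mult_ac)
qed

definition B :: "nat \<times> nat \<Rightarrow> real" where
  "B = (\<lambda>(m, n). M * M * (c ^ m * c ^ n))"

lemma summable_B: "B summable_on UNIV"
  using summable_on_cmult_right[OF summable_on_geometric_pairs[OF nm_ge_0 nm_q], of "M * M"]
  by (simp add: B_def case_prod_unfold)

text \<open>Away from the origin \<open>m + 3 * n\<close> is at least 1, so \<open>k\<close> gains a
  factor \<open>c ^ k\<close>; hence only the origin term survives as \<open>k\<close>
  grows.\<close>

lemma nm_T_power:
  assumes "k = 0 \<or> p \<noteq> (0, 0)"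
  shows "nm (T k p) \<le> c ^ k * B p"
proof -
  obtain m n where p: "p = (m, n)" by fastforce
  have "k \<le> k * (m + 3 * n)"
    using assms by (cases "m + 3 * n") (auto simp: p)
  then have "nm (q ^ (e m n + k * (m + 3 * n))) \<le> c ^ (k + (m + n))"
    using e_ge[of m n] by (intro nm_q_power) linarith
  then have "nm (q ^ (e m n + k * (m + 3 * n))) * (M * M) \<le> c ^ (k + (m + n)) * (M * M)"
    using M_pos by (intro mult_right_mono) auto
  with nm_T_le[of k m n] show ?thesis
    by (simp add: p B_def power_add mult_ac)
qed

lemma nm_T: "nm (T k p) \<le> B p"
proof -
  have B: "0 \<le> B p" by (cases p) (simp add: B_def M_pos)
  show ?thesis
  proof (cases "p = (0, 0)")
    case True
    then show ?thesis using nm_T_power[of 0 p] by (simp add: T_def e_def)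
  next
    case False
    have "c ^ k * B p \<le> 1 * B p"
      using nm_q B by (intro mult_right_mono power_le_one) auto
    with nm_T_power[of k p] False show ?thesis by simp
  qed
qed

definition f :: "nat \<Rightarrow> 'a" where
  "f k = infsum (T k) UNIV"

lemma has_sum_f: "(T k has_sum f k) UNIV"
  unfolding f_def
  using nm_summable_imp_summable_on[OF nm_T summable_B] by (simp add: has_sum_infsum)

lemma f_tendsto: "f \<longlonglongrightarrow> 1"
proof (rule tendsto_nmI)
  define G where "G = infsum B UNIV"
  have G: "(B has_sum G) UNIV"
    unfolding G_def using summable_B by (rule has_sum_infsum)
  show "nm (f k - 1) \<le> c ^ k * G" for k
  proof (rule nm_has_sum_le[OF _ has_sum_cmult_right[OF G]])
    \<comment> \<open>Removes the origin term of \<open>T k\<close>, which is 1 for every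
      \<open>k\<close>.\<close>
    let ?d = "\<lambda>p::nat \<times> nat. if p = (0, 0) then - 1 else 0 :: 'a"
    have "(?d has_sum (- 1)) {(0, 0)}"
      by (rule has_sum_finiteI) auto
    then have "(?d has_sum (- 1)) UNIV"
      by (rule has_sum_cong_neutral[THEN iffD1, rotated -1]) auto
    from has_sum_add[OF has_sum_f this, of k]
    show "((\<lambda>p. T k p + ?d p) has_sum (f k - 1)) UNIV" by simp
    show "nm (T k p + ?d p) \<le> c ^ k * B p" for p
    proof (cases "p = (0, 0)")
      case True
      then show ?thesis using M_pos by (simp add: T_def e_def R_def B_def)
    qed (use nm_T_power[of k p] in simp)
  qed
  have "(\<lambda>k. c ^ k * G) \<longlonglongrightarrow> 0 * G"
    using nm_q by (intro tendsto_intros LIMSEQ_power_zero) simp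
  then show "(\<lambda>k. c ^ k * G) \<longlonglongrightarrow> 0" by simp
qed

text \<open>Raising \<open>m\<close> costs one factor of \<open>R\<close> and shifts
  \<open>k\<close> by 2. \<open>T_Suc_right\<close> is the analogue for \<open>n\<close>, with a
  shift by 3 and a sign.\<close>

lemma T_Suc_left: "q ^ (3 * n) * (1 - q ^ Suc m) * T k (Suc m, n) = q ^ (k + 1) * T (k + 2) (m, n)"
proof -
  have x: "3 * n + (e (Suc m) n + k * (Suc m + 3 * n)) = (k + 1) + (e m n + (k + 2) * (m + 3 * n))"
    by (simp add: e_Suc_left algebra_simps)
  have "q ^ (3 * n) * (1 - q ^ Suc m) * T k (Suc m, n)
      = (- 1) ^ n * q ^ (3 * n + (e (Suc m) n + k * (Suc m + 3 * n)))
          * ((1 - q ^ Suc m) * R (Suc m)) * E 3 n"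
    unfolding T_def prod.case power_add[of q "3 * n"] by (simp only: mult_ac)
  also have "\<dots> = q ^ (k + 1) * T (k + 2) (m, n)"
    unfolding R_Suc x T_def prod.case power_add[of q "k + 1"] by (simp only: mult_ac)
  finally show ?thesis .
qed

lemma T_Suc_right: "(1 - q ^ (3 * Suc n)) * T k (m, Suc n) = - (q ^ (3 * k + 6)) * T (k + 3) (m, n)"
proof -
  have x: "e m (Suc n) + k * (m + 3 * Suc n) = (3 * k + 6) + (e m n + (k + 3) * (m + 3 * n))"
    by (simp add: e_Suc_right algebra_simps)
  have "(1 - q ^ (3 * Suc n)) * T k (m, Suc n)
      = (- 1) ^ Suc n * q ^ (e m (Suc n) + k * (m + 3 * Suc n)) * R m
          * ((1 - q ^ (3 * Suc n)) * E 3 (Suc n))"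
    unfolding T_def prod.case by (simp only: mult_ac)
  also have "\<dots> = - (q ^ (3 * k + 6)) * T (k + 3) (m, n)"
    unfolding E_three_Suc x T_def prod.case power_add[of q "3 * k + 6"] power_Suc
    by (simp only: mult_ac mult_minus_left mult_minus_right mult_1_left)
  finally show ?thesis .
qed

text \<open>Comes from \<open>1 - q\<^bsup>m+3n\<^esup> = (1 - q\<^bsup>3n\<^esup>) + q\<^bsup>3n\<^esup> (1 - q\<^sup>m)\<close> in each term.\<close>

lemma f_diff: "f k - f (k + 1) = q ^ (k + 1) * f (k + 2) - q ^ (3 * k + 6) * f (k + 3)"
proof -
  define L where "L = (\<lambda>(m, n). q ^ (3 * n) * (1 - q ^ m) * T k (m, n))"
  define H where "H = (\<lambda>(m, n). (1 - q ^ (3 * n)) * T k (m, n))"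
  \<comment> \<open>The factor \<open>1 - q ^ m\<close> kills the terms with \<open>m = 0\<close>;
    the others are reindexed by \<open>Suc\<close> and rewritten with \<open>T_Suc_left\<close>.
    \<open>H\<close> is treated alike in \<open>n\<close>.\<close>
  have "(L has_sum (q ^ (k + 1) * f (k + 2))) (range (\<lambda>(m, n). (Suc m, n)))"
  proof (subst has_sum_reindex)
    show "inj (\<lambda>(m, n). (Suc m, n :: nat))" by (auto simp: inj_on_def)
    have "L \<circ> (\<lambda>(m, n). (Suc m, n)) = (\<lambda>p. q ^ (k + 1) * T (k + 2) p)"
      using T_Suc_left by (auto simp: L_def fun_eq_iff)
    then show "(L \<circ> (\<lambda>(m, n). (Suc m, n)) has_sum (q ^ (k + 1) * f (k + 2))) UNIV"
      using has_sum_cmult_right[OF has_sum_f[of "k + 2"], of "q ^ (k + 1)"] by (simp only:)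
  qed
  moreover have "L p = 0" if "p \<notin> range (\<lambda>(m, n). (Suc m, n))" for p
  proof -
    obtain m n where p: "p = (m, n)" by fastforce
    with that have "m = 0" by (cases m) (auto simp: image_iff)
    then show ?thesis by (simp add: p L_def)
  qed
  ultimately have L: "(L has_sum (q ^ (k + 1) * f (k + 2))) UNIV"
    by (subst has_sum_cong_neutral[where S = UNIV and g = L
          and T = "range (\<lambda>(m, n). (Suc m, n))"]) auto
  have "(H has_sum (- (q ^ (3 * k + 6)) * f (k + 3))) (range (\<lambda>(m, n). (m, Suc n)))"
  proof (subst has_sum_reindex)
    show "inj (\<lambda>(m :: nat, n). (m, Suc n))" by (auto simp: inj_on_def)
    have "H \<circ> (\<lambda>(m, n). (m, Suc n)) = (\<lambda>p. - (q ^ (3 * k + 6)) * T (k + 3) p)"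
      using T_Suc_right by (auto simp: H_def fun_eq_iff)
    then show "(H \<circ> (\<lambda>(m, n). (m, Suc n)) has_sum (- (q ^ (3 * k + 6)) * f (k + 3))) UNIV"
      using has_sum_cmult_right[OF has_sum_f[of "k + 3"], of "- (q ^ (3 * k + 6))"] by (simp only:)
  qed
  moreover have "H p = 0" if "p \<notin> range (\<lambda>(m, n). (m, Suc n))" for p
  proof -
    obtain m n where p: "p = (m, n)" by fastforce
    with that have "n = 0" by (cases n) (auto simp: image_iff)
    then show ?thesis by (simp add: p H_def)
  qed
  ultimately have H: "(H has_sum (- (q ^ (3 * k + 6)) * f (k + 3))) UNIV"
    by (subst has_sum_cong_neutral[where S = UNIV and g = H
          and T = "range (\<lambda>(m, n). (m, Suc n))"]) auto
  have "((\<lambda>p. T k p + - 1 * T (k + 1) p) has_sum (f k + - 1 * f (k + 1))) UNIV"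
    by (intro has_sum_add has_sum_cmult_right has_sum_f)
  moreover have "T k p + - 1 * T (k + 1) p = L p + H p" for p
  proof -
    obtain m n where p: "p = (m, n)" by fastforce
    have x: "e m n + (k + 1) * (m + 3 * n) = m + 3 * n + (e m n + k * (m + 3 * n))"
      by (simp add: algebra_simps)
    have "T (k + 1) p = q ^ m * q ^ (3 * n) * T k p"
      unfolding p T_def prod.case x power_add[of q "m + 3 * n"] power_add[of q m] by (simp only: mult_ac)
    then show ?thesis
      unfolding p L_def H_def by (simp add: algebra_simps)
  qed
  ultimately have "((\<lambda>p. L p + H p) has_sum (f k + - 1 * f (k + 1))) UNIV"
    by (simp only:)
  from has_sum_unique[OF this has_sum_add[OF L H]] show ?thesis
    by simp
qed

lemma f_three_term: "f k = (1 + q ^ (k + 1)) * f (k + 1) - q ^ (2 * k + 3) * f (k + 2)"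
proof -
  \<comment> \<open>The defect \<open>D\<close> obeys a first-order recurrence with contracting factor, and it tends to 0.\<close>
  define D where "D k = f k - (1 + q ^ (k + 1)) * f (k + 1) + q ^ (2 * k + 3) * f (k + 2)" for k
  have step: "D k = - (q ^ (k + 1)) * D (k + 1)" for k
  proof -
    have "k + 1 + (2 * (k + 1) + 3) = 3 * k + 6" "k + 1 + (k + 1 + 1) = 2 * k + 3"
      by auto
    then have p: "q ^ (k + 1) * q ^ (2 * (k + 1) + 3) = q ^ (3 * k + 6)"
      "q ^ (k + 1) * q ^ (k + 1 + 1) = q ^ (2 * k + 3)"
      by (simp_all only: power_add[symmetric])
    have i: "k + 1 + 1 = k + 2" "k + 1 + 2 = k + 3" by auto
    have fk: "f k = f (k + 1) + (q ^ (k + 1) * f (k + 2) - q ^ (3 * k + 6) * f (k + 3))"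
      unfolding f_diff[symmetric] by (simp only: add_diff_cancel_left' add_diff_eq)
    show ?thesis
      unfolding D_def i fk p[unfolded i, symmetric] by algebra
  qed
  \<comment> \<open>Powers of \<open>q\<close> have norm at most 1, so the norms of \<open>D\<close>
    never decrease; tending to 0, they all vanish.\<close>
  have mono: "nm (D k) \<le> nm (D (k + n))" for n
  proof (induction n)
    case (Suc n)
    have "nm (D (k + n)) \<le> nm (q ^ (k + n + 1)) * nm (D (k + n + 1))"
      using nm_mult[of "- (q ^ (k + n + 1))" "D (k + n + 1)"] step[of "k + n"] by simp
    also have "\<dots> \<le> 1 * nm (D (k + n + 1))"
      using nm_q_power[of 0 "k + n + 1"] by (intro mult_right_mono) auto
    finally show ?case using Suc by simp
  qed simp
  have sub: "filterlim (\<lambda>n. k + n + j) sequentially sequentially" for j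
    by (rule filterlim_subseq) (auto simp: strict_mono_def)
  have fl: "(\<lambda>n. f (k + n + j)) \<longlonglongrightarrow> 1" for j
    by (rule filterlim_compose[OF f_tendsto sub])
  have ql: "(\<lambda>n. q ^ (k + n + j)) \<longlonglongrightarrow> 0" for j
    by (rule filterlim_compose[OF q_power_tendsto sub])
  have "(\<lambda>n. q ^ (2 * (k + n) + 3)) \<longlonglongrightarrow> 0"
    by (rule filterlim_compose[OF q_power_tendsto]) (rule filterlim_subseq, auto simp: strict_mono_def)
  then have "(\<lambda>n. f (k + n + 0) - (1 + q ^ (k + n + 1)) * f (k + n + 1)
      + q ^ (2 * (k + n) + 3) * f (k + n + 2)) \<longlonglongrightarrow> 1 - (1 + 0) * 1 + 0 * 1"
    by (intro tendsto_intros fl ql)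
  then have "(\<lambda>n. D (k + n)) \<longlonglongrightarrow> 0"
    by (simp add: D_def)
  then have "(\<lambda>n. nm (D (k + n))) \<longlonglongrightarrow> 0"
    by (subst (asm) tendsto_nm_iff) simp
  then have "nm (D k) \<le> 0"
    by (rule LIMSEQ_le_const) (use mono in auto)
  then have "D k = 0"
    by (simp add: nm_def)
  moreover have "D k = f k - ((1 + q ^ (k + 1)) * f (k + 1) - q ^ (2 * k + 3) * f (k + 2))"
    unfolding D_def by algebra
  ultimately show ?thesis by (simp only: right_minus_eq)
qed

section \<open>Casoratians and the values of f at 0 and 1\<close>

lemma casoratian_const:
  assumes rec: "\<And>n. y (n + 2) = (1 + q ^ (n + 1)) * y (n + 1) - q ^ (2 * n + 1) * y n"
  shows "f n * y (n + 1) - q ^ (2 * n + 1) * f (n + 1) * y n = f 0 * y 1 - q * f 1 * y 0"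
proof (induction n)
  case (Suc n)
  have "2 * Suc n + 1 = 2 * n + 3" "Suc n + 1 = n + 2" "Suc n = n + 1" by auto
  then have "f (Suc n) * y (Suc n + 1) - q ^ (2 * Suc n + 1) * f (Suc n + 1) * y (Suc n)
      = f (n + 1) * y (n + 2) - q ^ (2 * n + 3) * f (n + 2) * y (n + 1)"
    by (simp only:)
  \<comment> \<open>After expanding \<open>y (n + 2)\<close>, the coefficient of
    \<open>y (n + 1)\<close> is the right-hand side of the recurrence for
    \<open>f n\<close>.\<close>
  also have "\<dots> = f n * y (n + 1) - q ^ (2 * n + 1) * f (n + 1) * y n"
    unfolding rec f_three_term[of n] by (simp only: algebra_simps mult_1_left)
  finally show ?case using Suc by (simp only:)
qed simp

lemma casoratian_limit:
  assumes rec: "\<And>n. y (n + 2) = (1 + q ^ (n + 1)) * y (n + 1) - q ^ (2 * n + 1) * y n"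
    and lim: "y \<longlonglongrightarrow> l"
  shows "f 0 * y 1 - q * f 1 * y 0 = l"
proof -
  have "(\<lambda>n. q ^ (2 * n + 1)) \<longlonglongrightarrow> 0"
    by (rule filterlim_compose[OF q_power_tendsto]) (rule filterlim_subseq, auto simp: strict_mono_def)
  moreover have "(\<lambda>n. f (n + 1)) \<longlonglongrightarrow> 1" "(\<lambda>n. y (n + 1)) \<longlonglongrightarrow> l"
    using LIMSEQ_Suc[OF f_tendsto] LIMSEQ_Suc[OF lim] by auto
  ultimately have "(\<lambda>n. f n * y (n + 1) - q ^ (2 * n + 1) * f (n + 1) * y n) \<longlonglongrightarrow> 1 * l - 0 * 1 * l"
    using f_tendsto lim by (intro tendsto_intros)
  then show ?thesis
    unfolding casoratian_const[of y, OF rec] by (simp add: LIMSEQ_const_iff)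
qed

text \<open>The factor \<open>r 1\<close> normalises the solution to \<open>y 0 = 0\<close>,
  \<open>y 1 = 1\<close>, which makes the Casoratian \<open>f 0\<close>. It also completes the limit
  of \<open>E 4\<close> to that of \<open>E 1\<close>.\<close>

lemma f_0:
  assumes "E 1 \<longlonglongrightarrow> a"
  shows "f 0 = a"
proof -
  obtain b where b: "E 4 \<longlonglongrightarrow> b"
    using convergent_E[of 4] by (auto simp: convergent_def)
  then have "(\<lambda>n. r 1 * E 4 n) \<longlonglongrightarrow> r 1 * b"
    by (intro tendsto_intros)
  moreover have "(\<lambda>n. r 1 * E 4 n) = (\<lambda>n. E 1 (Suc n))"
    using E_Suc_shift[of 1] by simp
  ultimately have a: "a = r 1 * b"
    using LIMSEQ_Suc[OF assms] LIMSEQ_unique by metis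
  let ?y = "Y 1 (\<lambda>i. r 1 * w 4 i)"
  have rec: "?y (n + 2) = (1 + q ^ (n + 1)) * ?y (n + 1) - q ^ (2 * n + 1) * ?y n" for n
  proof (rule Y_rec)
    show "r 1 * w 4 (Suc i) = q ^ (2 * (3 * i + 1) + 2) * r (3 * i + 1 + 2) * r (3 * i + 1 + 3) * (r 1 * w 4 i)" for i
    proof -
      have "2 * (3 * i + 1) + 2 = 4 + 6 * i" "3 * i + 1 + 2 = 3 + 3 * i" "3 * i + 1 + 3 = 4 + 3 * i"
        by auto
      then show ?thesis unfolding w_Suc by (simp only: mult_ac)
    qed
  qed simp
  have "?y 0 = 0" "?y 1 = 1"
    using mult_r[of 1] by (simp_all add: Y_def Z_eq_0 Z_def w_def mult.commute)
  then show ?thesis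
    using casoratian_limit[OF rec Y_tendsto[OF _ b]] a by simp
qed

text \<open>The solution built on \<open>w 2\<close> starts with \<open>y 0 = y 1 = 1\<close>, so
  its Casoratian is \<open>f 0 - q * f 1\<close>.\<close>

lemma f_0_f_1:
  assumes "E 2 \<longlonglongrightarrow> b"
  shows "f 0 - q * f 1 = b"
proof -
  let ?y = "Y 0 (\<lambda>i. 1 * w 2 i)"
  have rec: "?y (n + 2) = (1 + q ^ (n + 1)) * ?y (n + 1) - q ^ (2 * n + 1) * ?y n" for n
  proof (rule Y_rec)
    show "1 * w 2 (Suc i) = q ^ (2 * (3 * i + 0) + 2) * r (3 * i + 0 + 2) * r (3 * i + 0 + 3) * (1 * w 2 i)" for i
    proof -
      have "2 * (3 * i + 0) + 2 = 2 + 6 * i" "3 * i + 0 + 2 = 2 + 3 * i" "3 * i + 0 + 3 = 3 + 3 * i"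
        by auto
      then show ?thesis unfolding w_Suc by (simp only: mult_ac mult_1_left)
    qed
  qed simp
  have "?y 0 = 1" "?y 1 = 1"
    by (simp_all add: Y_def Z_eq_0 w_def)
  then show ?thesis
    using casoratian_limit[OF rec Y_tendsto[OF _ assms]] by simp
qed


section \<open>The identity in terms of q-Pochhammer symbols\<close>

lemma div_eq_mult:
  assumes "x * y = (1 :: 'a)"
  shows "z div x = z * y"
proof -
  have "x \<noteq> 0" using assms by auto
  have "z = (z * y) * x"
    using assms by (simp add: mult.assoc mult.commute[of y])
  then have "z div x = (z * y) * x div x"
    by (rule arg_cong)
  also have "\<dots> = z * y"
    using \<open>x \<noteq> 0\<close> by (rule nonzero_mult_div_cancel_right)
  finally show ?thesis .
qed

lemma qpoch_eq_X: "qpoch (q ^ s) (q ^ 3) n = X s n"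
  by (simp only: qpoch_def X_def power_add power_mult)

lemma qpoch_inf_inverse:
  assumes "s > 0" "E s \<longlonglongrightarrow> a"
  shows "1 div qpoch_inf (q ^ s) (q ^ 3) = a"
proof -
  have "qpoch_inf (q ^ s) (q ^ 3) = prodinf (\<lambda>j. 1 - q ^ (s + 3 * j))"
    by (simp only: qpoch_inf_def power_add power_mult)
  with prodinf_mult_E_limit[OF assms] show ?thesis
    by (simp add: div_eq_mult)
qed

theorem double_sum:
  "((\<lambda>(m, n). ((- 1) ^ n * q ^ (3 * n * (3 * n + 1) div 2 + m\<^sup>2 + 3 * m * n + m + 3 * n + 1))
        div (qpoch q q m * qpoch (q ^ 3) (q ^ 3) n))
    has_sum (1 div qpoch_inf q (q ^ 3) - 1 div qpoch_inf (q ^ 2) (q ^ 3))) UNIV"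
proof -
  obtain a b where a: "E 1 \<longlonglongrightarrow> a" and b: "E 2 \<longlonglongrightarrow> b"
    using convergent_E[of 1] convergent_E[of 2] by (auto simp: convergent_def)
  \<comment> \<open>The double series is the difference of the two Casoratian constants.\<close>
  have "q * f 1 = f 0 - (f 0 - q * f 1)"
    by simp
  also have "\<dots> = a - b"
    using f_0[OF a] f_0_f_1[OF b] by simp
  also have "\<dots> = 1 div qpoch_inf q (q ^ 3) - 1 div qpoch_inf (q ^ 2) (q ^ 3)"
    using qpoch_inf_inverse[OF _ a] qpoch_inf_inverse[OF _ b] by simp
  finally have "((\<lambda>p. q * T 1 p) has_sum
      (1 div qpoch_inf q (q ^ 3) - 1 div qpoch_inf (q ^ 2) (q ^ 3))) UNIV"
    using has_sum_cmult_right[OF has_sum_f[of 1], of q] by simp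
  moreover have "q * T 1 (m, n) =
      ((- 1) ^ n * q ^ (3 * n * (3 * n + 1) div 2 + m\<^sup>2 + 3 * m * n + m + 3 * n + 1))
        div (qpoch q q m * qpoch (q ^ 3) (q ^ 3) n)" for m n
  proof -
    have "qpoch q q m * R m = 1"
      using prod_R[of m] by (simp add: qpoch_def)
    moreover have "qpoch (q ^ 3) (q ^ 3) n * E 3 n = 1"
      unfolding qpoch_eq_X by (rule X_E) simp
    ultimately have "(qpoch q q m * qpoch (q ^ 3) (q ^ 3) n) * (R m * E 3 n) = 1 * 1"
      by (metis mult.assoc mult.left_commute)
    then have "(qpoch q q m * qpoch (q ^ 3) (q ^ 3) n) * (R m * E 3 n) = 1"
      by simp
    moreover have "e m n + 1 * (m + 3 * n) + 1
        = 3 * n * (3 * n + 1) div 2 + m\<^sup>2 + 3 * m * n + m + 3 * n + 1"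
      by (simp add: e_def)
    ultimately show ?thesis
      by (simp only: div_eq_mult T_def prod.case flip: \<open>e m n + _ + 1 = _\<close>)
        (simp only: power_add power_one_right mult_ac)
  qed
  then have "(\<lambda>p. q * T 1 p) = (\<lambda>(m, n).
      ((- 1) ^ n * q ^ (3 * n * (3 * n + 1) div 2 + m\<^sup>2 + 3 * m * n + m + 3 * n + 1))
        div (qpoch q q m * qpoch (q ^ 3) (q ^ 3) n))"
    by (simp only: fun_eq_iff split_paired_All prod.case simp_thms)
  ultimately show ?thesis
    by (simp only:)
qed

end

theorem theorem6p4:
  shows "((\<lambda>(m, n).
            (- 1) ^ n * fps_X ^ (3 * n * (3 * n + 1) div 2 + m\<^sup>2 + 3 * m * n + m + 3 * n + 1)
              / (qpoch fps_X fps_X m * qpoch (fps_X ^ 3) (fps_X ^ 3) n))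
          has_sum
          (1 / qpoch_inf fps_X (fps_X ^ 3) - 1 / qpoch_inf (fps_X ^ 2) (fps_X ^ 3) :: complex fps))
          (UNIV :: (nat \<times> nat) set)
       \<and> (\<forall>q::complex. norm q < 1 \<longrightarrow>
         ((\<lambda>(m, n).
            (- 1) ^ n * q ^ (3 * n * (3 * n + 1) div 2 + m\<^sup>2 + 3 * m * n + m + 3 * n + 1)
              / (qpoch q q m * qpoch (q ^ 3) (q ^ 3) n))
          has_sum
          (1 / qpoch_inf q (q ^ 3) - 1 / qpoch_inf (q ^ 2) (q ^ 3)))
          (UNIV :: (nat \<times> nat) set))"
proof (intro conjI allI impI)
  interpret q_base "fps_X :: complex fps"
  proof
    show "nm (fps_X :: complex fps) < 1"
      by (simp add: nm_def dist_fps_def)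
    fix n :: nat assume "n > 0"
    \<comment> \<open>A power series over a field with nonzero constant coefficient is a
      unit.\<close>
    then have "fps_nth (1 - fps_X ^ n :: complex fps) 0 \<noteq> 0"
      by simp
    then show "(1 - fps_X ^ n :: complex fps) dvd 1"
      by (metis dvdI inverse_mult_eq_1')
  qed
  show "((\<lambda>(m, n).
            (- 1) ^ n * fps_X ^ (3 * n * (3 * n + 1) div 2 + m\<^sup>2 + 3 * m * n + m + 3 * n + 1)
              / (qpoch fps_X fps_X m * qpoch (fps_X ^ 3) (fps_X ^ 3) n))
          has_sum
          (1 / qpoch_inf fps_X (fps_X ^ 3) - 1 / qpoch_inf (fps_X ^ 2) (fps_X ^ 3) :: complex fps))
          (UNIV :: (nat \<times> nat) set)"
    by (rule double_sum)
next
  fix q :: complex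
  assume q: "norm q < 1"
  interpret q_base q
  proof
    show "nm q < 1"
      using q by (simp add: nm_def)
    fix n :: nat assume "n > 0"
    then have "norm (q ^ n) < 1"
      using q by (simp add: norm_power power_less_one_iff)
    then have "1 - q ^ n \<noteq> 0"
      by auto
    then show "1 - q ^ n dvd 1"
      by (simp add: dvd_field_iff)
  qed
  show "((\<lambda>(m, n).
            (- 1) ^ n * q ^ (3 * n * (3 * n + 1) div 2 + m\<^sup>2 + 3 * m * n + m + 3 * n + 1)
              / (qpoch q q m * qpoch (q ^ 3) (q ^ 3) n))
          has_sum
          (1 / qpoch_inf q (q ^ 3) - 1 / qpoch_inf (q ^ 2) (q ^ 3)))
          (UNIV :: (nat \<times> nat) set)"
    by (rule double_sum)
qed

end
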